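(* For every integer $p\ge 12$ there exist an integer $n\ge 2p$, real vector spaces $V^n$ and $U^p$ of dimensions $n$ and $p$, an endomorphism $J\in \mathrm{End}(V^n)$ with $J^2=-I$, a positive definite inner product $\langle\,,\,\rangle_{U^p}$ on $U^p$, and a symmetric bilinear form $\alpha\colon V^n\times V^n\to U^p$ satisfying $\alpha(JX,Y)=\alpha(X,JY)$ for all $X,Y\in V^n$, such that the symmetric bilinear form $\beta\colon V^n\times V^n\to W^{p,p}=U^p\oplus U^p$ defined by $$\beta(X,Y)=(\alpha(X,Y),\alpha(X,JY))$$ is flat with respect to the inner product $\langle\!\langle(\xi_1,\xi_2),(\eta_1,\eta_2)\rangle\!\rangle=\langle\xi_1,\eta_1\rangle_{U^p}-\langle\xi_2,\eta_2\rangle_{U^p}$ on $W^{p,p}$, the subspace $\mathcal{S}(\beta)$ is nondegenerate, and $\dim\mathcal{N}(\beta)<n-2p$.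
   Context: For a bilinear form $\beta\colon V\times V\to W$ between finite-dimensional real vector spaces, $\mathcal{S}(\beta)=\mathrm{span}\{\beta(X,Y): X,Y\in V\}$ and $\mathcal{N}(\beta)=\{Y\in V:\beta(X,Y)=0 \text{ for all } X\in V\}$. If $W$ carries an inner product $\langle\!\langle\,,\,\rangle\!\rangle$ (possibly indefinite), $\beta$ is called flat if $\langle\!\langle\beta(X,Y),\beta(Z,T)\rangle\!\rangle=\langle\!\langle\beta(X,T),\beta(Z,Y)\rangle\!\rangle$ for all $X,Y,Z,T\in V$. A subspace $L\subset W$ is nondegenerate if $L\cap L^\perp=\{0\}$. *)

theory Defs
  imports "HOL-Analysis.Analysis" "HOL-Analysis.Finite_Function_Topology"
begin

text \<open>
  Finite-dimensional vector spaces are rendered as subspaces of an ambient real vector space,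
  and maps between them are only constrained on these subspaces.
  The dimension of a subspace is the library's \<^const>\<open>dim\<close>; it is \<open>0\<close> for
  infinite-dimensional spaces, so \<open>dim V = n\<close> expresses finite-dimensionality once \<open>n > 0\<close>.
  As ambient space serves the space of finitely supported real sequences: every
  finite-dimensional real vector space is isomorphic to one of its subspaces, so quantifying over
  these subspaces amounts to quantifying over all finite-dimensional real vector spaces.
\<close>

type_synonym fin_seq = "(nat, real) poly_mapping"

definition linear_on ::
  "'a::real_vector set \<Rightarrow> 'b::real_vector set \<Rightarrow> ('a \<Rightarrow> 'b) \<Rightarrow> bool" where
  "linear_on V W f \<longleftrightarrow>
     (\<forall>x\<in>V. f x \<in> W) \<and>
     (\<forall>x\<in>V. \<forall>y\<in>V. f (x + y) = f x + f y) \<and>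
     (\<forall>c. \<forall>x\<in>V. f (c *\<^sub>R x) = c *\<^sub>R f x)"

definition bilinear_on ::
  "'a::real_vector set \<Rightarrow> 'b::real_vector set \<Rightarrow> ('a \<Rightarrow> 'a \<Rightarrow> 'b) \<Rightarrow> bool" where
  "bilinear_on V W \<beta> \<longleftrightarrow>
     (\<forall>x\<in>V. linear_on V W (\<lambda>y. \<beta> x y)) \<and> (\<forall>y\<in>V. linear_on V W (\<lambda>x. \<beta> x y))"

definition symmetric_bilinear_on ::
  "'a::real_vector set \<Rightarrow> 'b::real_vector set \<Rightarrow> ('a \<Rightarrow> 'a \<Rightarrow> 'b) \<Rightarrow> bool" where
  "symmetric_bilinear_on V W \<beta> \<longleftrightarrow>
     bilinear_on V W \<beta> \<and> (\<forall>x\<in>V. \<forall>y\<in>V. \<beta> x y = \<beta> y x)"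

definition pos_def_inner_on ::
  "'a::real_vector set \<Rightarrow> ('a \<Rightarrow> 'a \<Rightarrow> real) \<Rightarrow> bool" where
  "pos_def_inner_on U g \<longleftrightarrow>
     symmetric_bilinear_on U UNIV g \<and> (\<forall>x\<in>U. x \<noteq> 0 \<longrightarrow> g x x > 0)"

definition bil_span ::
  "'a set \<Rightarrow> ('a \<Rightarrow> 'a \<Rightarrow> 'b::real_vector) \<Rightarrow> 'b set" where
  "bil_span V \<beta> = span {\<beta> x y | x y. x \<in> V \<and> y \<in> V}"

definition bil_nullity ::
  "'a set \<Rightarrow> ('a \<Rightarrow> 'a \<Rightarrow> 'b::real_vector) \<Rightarrow> 'a set" where
  "bil_nullity V \<beta> = {y \<in> V. \<forall>x\<in>V. \<beta> x y = 0}"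

definition flat_on ::
  "'a set \<Rightarrow> ('b \<Rightarrow> 'b \<Rightarrow> real) \<Rightarrow> ('a \<Rightarrow> 'a \<Rightarrow> 'b) \<Rightarrow> bool" where
  "flat_on V h \<beta> \<longleftrightarrow>
     (\<forall>x\<in>V. \<forall>y\<in>V. \<forall>z\<in>V. \<forall>t\<in>V. h (\<beta> x y) (\<beta> z t) = h (\<beta> x t) (\<beta> z y))"

definition orth_compl ::
  "'b set \<Rightarrow> ('b \<Rightarrow> 'b \<Rightarrow> real) \<Rightarrow> 'b set \<Rightarrow> 'b set" where
  "orth_compl W h L = {w \<in> W. \<forall>l\<in>L. h w l = 0}"

definition nondegenerate_in ::
  "'b::real_vector set \<Rightarrow> ('b \<Rightarrow> 'b \<Rightarrow> real) \<Rightarrow> 'b set \<Rightarrow> bool" where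
  "nondegenerate_in W h L \<longleftrightarrow> L \<inter> orth_compl W h L = {0}"

definition split_inner ::
  "('b \<Rightarrow> 'b \<Rightarrow> real) \<Rightarrow> 'b \<times> 'b \<Rightarrow> 'b \<times> 'b \<Rightarrow> real" where
  "split_inner g v w = g (fst v) (fst w) - g (snd v) (snd w)"

definition beta_form ::
  "('a \<Rightarrow> 'a) \<Rightarrow> ('a \<Rightarrow> 'a \<Rightarrow> 'b) \<Rightarrow> 'a \<Rightarrow> 'a \<Rightarrow> 'b \<times> 'b" where
  "beta_form J \<alpha> x y = (\<alpha> x y, \<alpha> x (J y))"

end

(* Writing V = C^m with J = i, such an \<alpha> is the real part of a complex symmetric bilinear form B
   with values in C^p, and \<beta> is flat iff B(X,Y) . B(Z,T) is totally symmetric, i.e. iff it is the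
   polarisation of a quartic on C^m. The complex dimension of S(\<beta>) and the complex codimension of
   N(\<beta>) are then the middle and first entries of the Hilbert function of that quartic (of its
   apolar algebra), so a non-unimodal Hilbert function is needed. Stanley's quartic
   \<Sum> y_m m, where m runs over the ten cubic monomials in three variables and the y_m are ten further
   variables, has Hilbert function (1, 13, 12, 13, 1); adding fourth powers of p - 12 new variables
   gives (1, p+1, p, p+1, 1). *)

theory Submission
  imports Defs
begin

subsection \<open>Coordinate subspaces of finitely supported sequences\<close>

abbreviation "lookup \<equiv> Poly_Mapping.lookup"

definition coord_space :: "nat \<Rightarrow> fin_seq set" where
  "coord_space n = {x. \<forall>i\<ge>n. lookup x i = 0}"

definition coord_vec :: "nat \<Rightarrow> (nat \<Rightarrow> real) \<Rightarrow> fin_seq" where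
  "coord_vec n f = Abs_poly_mapping (\<lambda>i. if i < n then f i else 0)"

lemma lookup_coord_vec: "lookup (coord_vec n f) i = (if i < n then f i else 0)"
proof -
  have "finite {i. (if i < n then f i else 0) \<noteq> 0}"
    by (rule finite_subset[of _ "{..<n}"]) auto
  then show ?thesis
    by (simp add: coord_vec_def)
qed

lemma coord_vec_in_coord_space [simp]: "coord_vec n f \<in> coord_space n"
  by (simp add: coord_space_def lookup_coord_vec)

lemma lookup_scaleR_fin_seq: "lookup (c *\<^sub>R (x :: fin_seq)) i = c * lookup x i"
proof -
  have "finite {i. c *\<^sub>R lookup x i \<noteq> 0}"
    by (rule finite_subset[OF _ finite_lookup[of x]]) auto
  then show ?thesis
    by (simp add: scaleR_poly_mapping_def)
qed

lemma subspace_coord_space: "subspace (coord_space n)"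
  by (auto simp: subspace_def coord_space_def lookup_add lookup_scaleR_fin_seq)

lemma dim_coord_space: "dim (coord_space n) = n"
proof (rule dim_unique)
  let ?e = "\<lambda>i. Poly_Mapping.single i (1::real)"
  have inj: "inj_on ?e {..<n}"
    by (auto simp: inj_on_def) (metis lookup_single_eq lookup_single_not_eq zero_neq_one)
  show "?e ` {..<n} \<subseteq> coord_space n"
    by (auto simp: coord_space_def lookup_single)
  show "coord_space n \<subseteq> span (?e ` {..<n})"
  proof
    fix x assume "x \<in> coord_space n"
    then have "x = (\<Sum>i<n. lookup x i *\<^sub>R ?e i)"
      by (intro poly_mapping_eqI)
        (auto simp: lookup_sum lookup_scaleR_fin_seq lookup_single when_def coord_space_def
          if_distrib[of "(*) _"] cong: if_cong)
    also have "\<dots> \<in> span (?e ` {..<n})"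
      by (intro span_sum span_scale span_base) auto
    finally show "x \<in> span (?e ` {..<n})" .
  qed
  show "independent (?e ` {..<n})"
    unfolding independent_explicit_finite_subsets
  proof (intro allI impI ballI)
    fix S u v
    assume S: "S \<subseteq> ?e ` {..<n}" "finite S" and 0: "(\<Sum>v\<in>S. u v *\<^sub>R v) = 0" and v: "v \<in> S"
    from v S obtain i where i: "v = ?e i"
      by auto
    have "0 = (\<Sum>w\<in>S. u w * lookup w i)"
      using arg_cong[OF 0, of "\<lambda>x. lookup x i"]
      by (simp add: lookup_sum lookup_scaleR_fin_seq)
    also have "\<dots> = (\<Sum>w\<in>S. if w = v then u w else 0)"
      using S i by (intro sum.cong) (auto simp: lookup_single when_def split: if_splits)
    also have "\<dots> = u v"
      using v S by simp
    finally show "u v = 0" by simp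
  qed
  show "card (?e ` {..<n}) = n"
    using inj by (simp add: card_image)
qed

definition coord_inner :: "nat \<Rightarrow> fin_seq \<Rightarrow> fin_seq \<Rightarrow> real" where
  "coord_inner p x y = (\<Sum>i<p. lookup x i * lookup y i)"

lemma pos_def_coord_inner: "pos_def_inner_on (coord_space p) (coord_inner p)"
proof -
  have "coord_inner p x x > 0" if x: "x \<in> coord_space p" "x \<noteq> 0" for x
  proof -
    obtain i where i: "lookup x i \<noteq> 0"
      using x(2) by (metis lookup_zero poly_mapping_eqI)
    with x(1) have "i < p"
      unfolding coord_space_def using not_le by blast
    then show ?thesis
      unfolding coord_inner_def using i
      by (intro sum_pos2[of _ i]) (auto simp: zero_less_mult_iff)
  qed
  then show ?thesis
    by (auto simp: pos_def_inner_on_def symmetric_bilinear_on_def bilinear_on_def linear_on_def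
        coord_inner_def lookup_add lookup_scaleR_fin_seq algebra_simps sum.distrib sum_distrib_left)
qed

section \<open>Complex coordinates and multiplication by i\<close>

definition complex_coords :: "nat \<Rightarrow> fin_seq \<Rightarrow> nat \<Rightarrow> complex" where
  "complex_coords k x j = (if j < k then Complex (lookup x j) (lookup x (k + j)) else 0)"

text \<open>Real coordinates \<open>j\<close> and \<open>k + j\<close> hold the real and imaginary
  parts of \<open>z j\<close>. Vectors of C^k are encoded as functions vanishing from index
  \<open>k\<close> on; on these, \<open>realify\<close> and \<open>complex_coords\<close> are
  mutually inverse.\<close>

definition realify :: "nat \<Rightarrow> (nat \<Rightarrow> complex) \<Rightarrow> fin_seq" where
  "realify k z = coord_vec (2 * k) (\<lambda>i. if i < k then Re (z i) else Im (z (i - k)))"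

lemma realify_in_coord_space [simp]: "realify k z \<in> coord_space (2 * k)"
  by (simp add: realify_def)

lemma complex_coords_realify:
  assumes "\<And>j. k \<le> j \<Longrightarrow> z j = 0"
  shows "complex_coords k (realify k z) = z"
  using assms by (auto simp: complex_coords_def realify_def lookup_coord_vec fun_eq_iff)

lemma realify_complex_coords:
  assumes "x \<in> coord_space (2 * k)"
  shows "realify k (complex_coords k x) = x"
  using assms
  by (intro poly_mapping_eqI) (auto simp: complex_coords_def realify_def lookup_coord_vec coord_space_def)

lemma complex_coords_add:
  "complex_coords k (x + y) = (\<lambda>j. complex_coords k x j + complex_coords k y j)"
  by (auto simp: complex_coords_def lookup_add fun_eq_iff complex_eq_iff)

lemma complex_coords_scaleR:
  "complex_coords k (c *\<^sub>R x) = (\<lambda>j. complex_of_real c * complex_coords k x j)"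
  by (auto simp: complex_coords_def lookup_scaleR_fin_seq fun_eq_iff complex_eq_iff)

definition mult_i :: "nat \<Rightarrow> fin_seq \<Rightarrow> fin_seq" where
  "mult_i k x = realify k (\<lambda>j. \<i> * complex_coords k x j)"

lemma complex_coords_mult_i:
  "complex_coords k (mult_i k x) = (\<lambda>j. \<i> * complex_coords k x j)"
  unfolding mult_i_def by (rule complex_coords_realify) (simp add: complex_coords_def)

lemma mult_i_in_coord_space [simp]: "mult_i k x \<in> coord_space (2 * k)"
  by (simp add: mult_i_def)

lemma linear_on_mult_i: "linear_on (coord_space (2 * k)) (coord_space (2 * k)) (mult_i k)"
  unfolding linear_on_def
  by (auto intro!: poly_mapping_eqI simp: mult_i_def realify_def lookup_coord_vec lookup_add
      lookup_scaleR_fin_seq complex_coords_add complex_coords_scaleR distrib_left)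

lemma mult_i_mult_i:
  assumes "x \<in> coord_space (2 * k)"
  shows "mult_i k (mult_i k x) = - x"
proof -
  have "mult_i k (mult_i k x) = realify k (\<lambda>j. - complex_coords k x j)"
    by (simp add: mult_i_def[of k "mult_i k x"] complex_coords_mult_i flip: mult.assoc)
  also have "\<dots> = - realify k (complex_coords k x)"
    by (auto intro!: poly_mapping_eqI simp: realify_def lookup_coord_vec)
  finally show ?thesis
    using assms by (simp add: realify_complex_coords)
qed

subsection \<open>Real parts of complex flat forms\<close>

text \<open>Flatness is meant for the complex bilinear dot product, without conjugation.
  \<open>full_span\<close> is stated dually, as the vanishing of every functional on C^p that kills
  all values of \<open>B\<close>; nondegeneracy needs it in this form.\<close>

locale complex_flat_form =
  fixes k p :: nat and B :: "(nat \<Rightarrow> complex) \<Rightarrow> (nat \<Rightarrow> complex) \<Rightarrow> nat \<Rightarrow> complex"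
  assumes sym: "B z w i = B w z i"
    and add_right: "B z (\<lambda>j. w j + w' j) i = B z w i + B z w' i"
    and scale_right: "B z (\<lambda>j. c * w j) i = c * B z w i"
    and flat: "(\<Sum>i<p. B x y i * B z t i) = (\<Sum>i<p. B x t i * B z y i)"
    and trivial_nullity:
      "\<lbrakk>\<And>j. k \<le> j \<Longrightarrow> w j = 0;
        \<And>z i. \<lbrakk>\<And>j. k \<le> j \<Longrightarrow> z j = 0; i < p\<rbrakk> \<Longrightarrow> B z w i = 0\<rbrakk> \<Longrightarrow> w j = 0"
    and full_span:
      "\<lbrakk>\<And>z w. \<lbrakk>\<And>j. k \<le> j \<Longrightarrow> z j = 0; \<And>j. k \<le> j \<Longrightarrow> w j = 0\<rbrakk>
          \<Longrightarrow> (\<Sum>i<p. d i * B z w i) = 0; i < p\<rbrakk> \<Longrightarrow> d i = 0"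
begin

abbreviation "V \<equiv> coord_space (2 * k)"
abbreviation "U \<equiv> coord_space p"
abbreviation "J \<equiv> mult_i k"

definition \<alpha> :: "fin_seq \<Rightarrow> fin_seq \<Rightarrow> fin_seq" where
  "\<alpha> x y = coord_vec p (\<lambda>i. Re (B (complex_coords k x) (complex_coords k y) i))"

abbreviation "\<beta> \<equiv> beta_form J \<alpha>"

lemma add_left: "B (\<lambda>j. w j + w' j) z i = B w z i + B w' z i"
  by (metis add_right sym)

lemma scale_left: "B (\<lambda>j. c * w j) z i = c * B w z i"
  by (metis scale_right sym)

lemmas bilin = add_left scale_left add_right scale_right

lemma lookup_fst_beta:
  "lookup (fst (\<beta> x y)) i = (if i < p then Re (B (complex_coords k x) (complex_coords k y) i) else 0)"
  by (simp add: beta_form_def \<alpha>_def lookup_coord_vec)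

text \<open>The sign is that of Re (i b) = - Im b.\<close>

lemma lookup_snd_beta:
  "lookup (snd (\<beta> x y)) i = (if i < p then - Im (B (complex_coords k x) (complex_coords k y) i) else 0)"
  by (simp add: beta_form_def \<alpha>_def lookup_coord_vec complex_coords_mult_i bilin)

text \<open>Reading a pair (a, b) as a - i b turns the split inner product into the real part of the
  complex dot product, so complex flatness of \<open>B\<close> passes to \<beta>.\<close>

lemma split_inner_beta:
  "split_inner (coord_inner p) w (\<beta> x y) =
    Re (\<Sum>i<p. Complex (lookup (fst w) i) (- lookup (snd w) i)
      * B (complex_coords k x) (complex_coords k y) i)"
  by (simp add: split_inner_def coord_inner_def lookup_fst_beta lookup_snd_beta sum.distrib sum_negf
      sum_subtractf)

lemma split_inner_beta_beta:
  "split_inner (coord_inner p) (\<beta> x y) (\<beta> z t) =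
    Re (\<Sum>i<p. B (complex_coords k x) (complex_coords k y) i
      * B (complex_coords k z) (complex_coords k t) i)"
  unfolding split_inner_beta
  by (intro arg_cong[of _ _ Re] sum.cong) (simp_all add: lookup_fst_beta lookup_snd_beta complex_eq_iff)

lemma symmetric_bilinear_alpha: "symmetric_bilinear_on V U \<alpha>"
  unfolding symmetric_bilinear_on_def bilinear_on_def linear_on_def
  by (auto intro!: poly_mapping_eqI simp: \<alpha>_def lookup_coord_vec lookup_add lookup_scaleR_fin_seq
      complex_coords_add complex_coords_scaleR bilin sym)

lemma alpha_J: "\<alpha> (J x) y = \<alpha> x (J y)"
  by (simp add: \<alpha>_def complex_coords_mult_i bilin)

lemma symmetric_bilinear_beta: "symmetric_bilinear_on V (U \<times> U) \<beta>"
proof -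
  have mem: "\<beta> x y \<in> U \<times> U" for x y
    by (simp add: beta_form_def \<alpha>_def)
  have comm: "\<beta> x y = \<beta> y x" for x y
    by (intro prod_eqI poly_mapping_eqI) (simp_all add: lookup_fst_beta lookup_snd_beta sym)
  have right: "\<beta> x (y + y') = \<beta> x y + \<beta> x y'" "\<beta> x (c *\<^sub>R y) = c *\<^sub>R \<beta> x y" for x y y' c
    by (auto intro!: prod_eqI poly_mapping_eqI simp: lookup_fst_beta lookup_snd_beta lookup_add
        lookup_scaleR_fin_seq complex_coords_add complex_coords_scaleR bilin)
  have left: "\<beta> (y + y') x = \<beta> y x + \<beta> y' x" "\<beta> (c *\<^sub>R y) x = c *\<^sub>R \<beta> y x" for x y y' c
    by (simp_all only: comm[of _ x] right)
  show ?thesis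
    unfolding symmetric_bilinear_on_def bilinear_on_def linear_on_def
    by (intro conjI ballI allI mem left right comm)
qed

lemma flat_beta: "flat_on V (split_inner (coord_inner p)) \<beta>"
  unfolding flat_on_def split_inner_beta_beta
  by (intro ballI arg_cong[of _ _ Re] flat)

lemma nullity_beta: "bil_nullity V \<beta> = {0}"
proof (intro set_eqI iffI)
  fix y assume "y \<in> bil_nullity V \<beta>"
  then have y: "y \<in> V" and null: "\<And>x. x \<in> V \<Longrightarrow> \<beta> x y = 0"
    by (auto simp: bil_nullity_def)
  have "complex_coords k y j = 0" for j
  proof (rule trivial_nullity)
    fix z :: "nat \<Rightarrow> complex" and i
    assume z: "\<And>j. k \<le> j \<Longrightarrow> z j = 0" and i: "i < p"
    have "\<beta> (realify k z) y = 0"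
      by (rule null) simp
    then have "lookup (fst (\<beta> (realify k z) y)) i = 0" "lookup (snd (\<beta> (realify k z) y)) i = 0"
      by simp_all
    with z i show "B z (complex_coords k y) i = 0"
      by (simp add: lookup_fst_beta lookup_snd_beta complex_coords_realify complex_eq_iff)
  qed (simp add: complex_coords_def)
  then have "realify k (complex_coords k y) = 0"
    by (intro poly_mapping_eqI) (simp add: realify_def lookup_coord_vec)
  then show "y \<in> {0}"
    using y by (simp add: realify_complex_coords)
next
  fix y :: fin_seq assume "y \<in> {0}"
  moreover have "complex_coords k 0 = (\<lambda>_. 0)"
    by (auto simp: complex_coords_def complex_eq_iff)
  then have "\<beta> x 0 = 0" for x
    using scale_right[of _ 0 "\<lambda>_. 0"]
    by (auto intro!: prod_eqI poly_mapping_eqI simp: lookup_fst_beta lookup_snd_beta)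
  ultimately show "y \<in> bil_nullity V \<beta>"
    by (simp add: bil_nullity_def coord_space_def)
qed

lemma nondegenerate_beta:
  "nondegenerate_in (U \<times> U) (split_inner (coord_inner p)) (bil_span V \<beta>)"
proof -
  have "w = 0" if w: "w \<in> orth_compl (U \<times> U) (split_inner (coord_inner p)) (bil_span V \<beta>)" for w
  proof -
    let ?c = "\<lambda>i. Complex (lookup (fst w) i) (- lookup (snd w) i)"
    have orth: "split_inner (coord_inner p) w (\<beta> x y) = 0" if "x \<in> V" "y \<in> V" for x y
    proof -
      have "\<beta> x y \<in> bil_span V \<beta>"
        unfolding bil_span_def using that by (intro span_base CollectI exI[of _ x] exI[of _ y] conjI refl)
      then show ?thesis
        using w unfolding orth_compl_def by blast
    qed
    have "?c i = 0" if "i < p" for i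
    proof (rule full_span[OF _ that])
      fix z v :: "nat \<Rightarrow> complex"
      assume z: "\<And>j. k \<le> j \<Longrightarrow> z j = 0" and v: "\<And>j. k \<le> j \<Longrightarrow> v j = 0"
      have "Re (\<Sum>i<p. ?c i * B z v i) = 0"
        using orth[of "realify k z" "realify k v"] z v
        by (simp only: split_inner_beta complex_coords_realify realify_in_coord_space)
      \<comment> \<open>Replacing \<open>v\<close> by i \<open>v\<close> multiplies the sum by i, so
        its imaginary part vanishes too.\<close>
      moreover have "Re (\<Sum>i<p. ?c i * B z (\<lambda>j. \<i> * v j) i) = 0"
        using orth[of "realify k z" "realify k (\<lambda>j. \<i> * v j)"] z v
        by (simp only: split_inner_beta complex_coords_realify realify_in_coord_space mult_zero_right)
      then have "Re (\<i> * (\<Sum>i<p. ?c i * B z v i)) = 0"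
        by (simp only: scale_right sum_distrib_left mult.left_commute)
      then have "Im (\<Sum>i<p. ?c i * B z v i) = 0"
        by simp
      ultimately show "(\<Sum>i<p. ?c i * B z v i) = 0"
        by (simp only: complex_eq_iff zero_complex.sel)
    qed
    moreover have "w \<in> U \<times> U"
      using w unfolding orth_compl_def by blast
    then have "lookup (fst w) i = 0" "lookup (snd w) i = 0" if "p \<le> i" for i
      using that by (auto simp: coord_space_def)
    ultimately show "w = 0"
      by (intro prod_eqI poly_mapping_eqI) (metis complex.sel lookup_zero fst_zero snd_zero
          neg_equal_0_iff_equal not_le zero_complex.sel)+
  qed
  moreover have "0 \<in> orth_compl (U \<times> U) (split_inner (coord_inner p)) (bil_span V \<beta>)"
    by (auto simp: orth_compl_def split_inner_def coord_inner_def coord_space_def zero_prod_def)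
  moreover have "0 \<in> bil_span V \<beta>"
    unfolding bil_span_def by (rule span_zero)
  ultimately show ?thesis
    unfolding nondegenerate_in_def by blast
qed

end

subsection \<open>The quartic with Hilbert function (1, 13, 12, 13, 1)\<close>

text \<open>Entries are indexed by the pairs 00, 01, 11, 02, 12, 22. The mixed ones count both
  orders, so pairing with a symmetric 3 by 3 array sums over all ordered index pairs.\<close>

definition quadric :: "(nat \<Rightarrow> complex) \<Rightarrow> (nat \<Rightarrow> complex) \<Rightarrow> nat \<Rightarrow> complex" where
  "quadric z w i = [z 0 * w 0, z 0 * w 1 + z 1 * w 0, z 1 * w 1,
    z 0 * w 2 + z 2 * w 0, z 1 * w 2 + z 2 * w 1, z 2 * w 2] ! i"

text \<open>Coordinates \<open>3, \<dots>, 12\<close> are the variables \<open>y_m\<close> for the cubic monomials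
  000, 001, 011, 111, 002, 012, 112, 022, 122, 222 in the coordinates \<open>0, 1, 2\<close>.\<close>

definition cubic :: "(nat \<Rightarrow> complex) \<Rightarrow> (nat \<Rightarrow> complex) \<Rightarrow> nat \<Rightarrow> complex" where
  "cubic z w i =
    [z 3 * w 0 + z 4 * w 1 + z 7 * w 2, z 4 * w 0 + z 5 * w 1 + z 8 * w 2,
     z 5 * w 0 + z 6 * w 1 + z 9 * w 2, z 7 * w 0 + z 8 * w 1 + z 10 * w 2,
     z 8 * w 0 + z 9 * w 1 + z 11 * w 2, z 10 * w 0 + z 11 * w 1 + z 12 * w 2] ! i"

text \<open>Up to a constant, the entry at ab is the polarised second derivative in variables a, b
  of the sum of y_abc x_a x_b x_c over all a, b, c, which is Stanley's quartic with the y_m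
  rescaled.\<close>

definition hess :: "(nat \<Rightarrow> complex) \<Rightarrow> (nat \<Rightarrow> complex) \<Rightarrow> nat \<Rightarrow> complex" where
  "hess z w i = cubic z w i + cubic w z i"

text \<open>The sum and \<open>\<i>\<close> times the difference of \<open>quadric\<close> and \<open>hess\<close> diagonalise the hyperbolic
  pairing between them; the remaining components belong to the fourth powers of further variables.\<close>

definition stanley_form :: "(nat \<Rightarrow> complex) \<Rightarrow> (nat \<Rightarrow> complex) \<Rightarrow> nat \<Rightarrow> complex" where
  "stanley_form z w i =
    (if i < 6 then quadric z w i + hess z w i
     else if i < 12 then \<i> * (quadric z w (i - 6) - hess z w (i - 6))
     else z (Suc i) * w (Suc i))"

lemma less_6_cases: "(i::nat) < 6 \<Longrightarrow> i = 0 \<or> i = 1 \<or> i = 2 \<or> i = 3 \<or> i = 4 \<or> i = 5"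
  by linarith

lemma quadric_bilinear:
  assumes "i < 6"
  shows "quadric z w i = quadric w z i"
    "quadric z (\<lambda>j. w j + w' j) i = quadric z w i + quadric z w' i"
    "quadric z (\<lambda>j. c * w j) i = c * quadric z w i"
  using less_6_cases[OF assms] by (auto simp: quadric_def algebra_simps)

lemma hess_bilinear:
  assumes "i < 6"
  shows "hess z w i = hess w z i"
    "hess z (\<lambda>j. w j + w' j) i = hess z w i + hess z w' i"
    "hess z (\<lambda>j. c * w j) i = c * hess z w i"
  using less_6_cases[OF assms] by (auto simp: hess_def cubic_def algebra_simps)

text \<open>Undoes the diagonalisation. It serves both the inner product of two values, where the
  coefficients become twice \<open>hess\<close> and twice \<open>quadric\<close>, and the full span
  condition.\<close>

lemma stanley_form_sum_12:
  "(\<Sum>i<12. c i * stanley_form z w i) =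
    (\<Sum>i<6. (c i + \<i> * c (i + 6)) * quadric z w i + (c i - \<i> * c (i + 6)) * hess z w i)"
proof -
  have "(\<Sum>i<12. c i * stanley_form z w i) =
      (\<Sum>i<6. c i * stanley_form z w i) + (\<Sum>i<6. c (i + 6) * stanley_form z w (i + 6))"
    using sum.nat_group[of "\<lambda>i. c i * stanley_form z w i" 6 2]
    by (simp add: sum.atLeast_Suc_lessThan lessThan_Suc eval_nat_numeral ac_simps)
  then show ?thesis
    by (simp add: stanley_form_def algebra_simps flip: sum.distrib)
qed

text \<open>Let Y(z) be the symmetric trilinear form with coefficients y_abc of \<open>z\<close>.
  Either side is Y(x)(y,z,t) + Y(y)(x,z,t) + Y(z)(x,y,t) + Y(t)(x,y,z), symmetric in all four
  vectors.\<close>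

lemma quadric_hess_flat:
  "(\<Sum>i<6. quadric x y i * hess z t i + hess x y i * quadric z t i) =
   (\<Sum>i<6. quadric x t i * hess z y i + hess x t i * quadric z y i)"
  by (simp add: lessThan_Suc eval_nat_numeral quadric_def hess_def cubic_def) algebra

lemma sum_split_12:
  fixes f :: "nat \<Rightarrow> complex"
  assumes "12 \<le> p"
  shows "(\<Sum>i<p. f i) = (\<Sum>i<12. f i) + (\<Sum>i=12..<p. f i)"
  using assms by (metis atLeast0LessThan le0 sum.atLeastLessThan_concat)

lemma stanley_form_inner:
  assumes "12 \<le> p"
  shows "(\<Sum>i<p. stanley_form x y i * stanley_form z t i) =
    2 * (\<Sum>i<6. quadric x y i * hess z t i + hess x y i * quadric z t i) +
    (\<Sum>i=12..<p. x (Suc i) * y (Suc i) * (z (Suc i) * t (Suc i)))"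
proof -
  have "(\<Sum>i<12. stanley_form x y i * stanley_form z t i) =
      2 * (\<Sum>i<6. quadric x y i * hess z t i + hess x y i * quadric z t i)"
    unfolding stanley_form_sum_12 sum_distrib_left
    by (rule sum.cong) (simp_all add: stanley_form_def algebra_simps)
  then show ?thesis
    using sum_split_12[OF assms] by (simp add: stanley_form_def)
qed

section \<open>Flatness, nullity and span of the Stanley form\<close>

definition unit_vec :: "nat \<Rightarrow> nat \<Rightarrow> complex" where
  "unit_vec a j = (if j = a then 1 else 0)"

lemma complex_flat_form_stanley_form:
  assumes p: "12 \<le> p"
  shows "complex_flat_form (Suc p) p stanley_form"
proof
  show "stanley_form z w i = stanley_form w z i" for z w i
    using quadric_bilinear(1) hess_bilinear(1) by (simp add: stanley_form_def)
  show "stanley_form z (\<lambda>j. w j + w' j) i = stanley_form z w i + stanley_form z w' i" for z w w' i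
    by (simp add: stanley_form_def quadric_bilinear hess_bilinear algebra_simps)
  show "stanley_form z (\<lambda>j. c * w j) i = c * stanley_form z w i" for z w c i
    by (simp add: stanley_form_def quadric_bilinear hess_bilinear algebra_simps)
  show "(\<Sum>i<p. stanley_form x y i * stanley_form z t i) =
      (\<Sum>i<p. stanley_form x t i * stanley_form z y i)" for x y z t
    unfolding stanley_form_inner[OF p] quadric_hess_flat[of x y z t] by (simp add: ac_simps)
next
  fix w :: "nat \<Rightarrow> complex" and j
  assume w: "\<And>j. Suc p \<le> j \<Longrightarrow> w j = 0"
    and null: "\<And>z i. \<lbrakk>\<And>j. Suc p \<le> j \<Longrightarrow> z j = 0; i < p\<rbrakk> \<Longrightarrow> stanley_form z w i = 0"
  have unit: "stanley_form (unit_vec a) w i = 0" if "a \<le> p" "i < p" for a i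
    using that by (intro null) (auto simp: unit_vec_def)
  have q0: "quadric (unit_vec a) w i = 0" and h0: "hess (unit_vec a) w i = 0"
    if "a \<le> p" "i < 6" for a i
    using unit[of a i] unit[of a "i + 6"] that p by (auto simp: stanley_form_def)
  consider "j < 13" | "13 \<le> j" "j \<le> p" | "Suc p \<le> j"
    by linarith
  then show "w j = 0"
  proof cases
    case 1
    then have "j = 0 \<or> j = 1 \<or> j = 2 \<or> j = 3 \<or> j = 4 \<or> j = 5 \<or> j = 6 \<or> j = 7 \<or> j = 8
        \<or> j = 9 \<or> j = 10 \<or> j = 11 \<or> j = 12"
      by presburger
    then show ?thesis
      \<comment> \<open>The \<open>q0\<close> facts isolate \<open>w\<close> at 0, 1, 2. Each
        \<open>h0\<close> fact pairs with one of the first three basis vectors and isolates a single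
        y_m, in the order of coordinates 3 to 12.\<close>
      using q0[of 0 0] q0[of 1 2] q0[of 2 5]
        h0[of 0 0] h0[of 0 1] h0[of 0 2] h0[of 1 2] h0[of 0 3] h0[of 0 4] h0[of 1 4] h0[of 0 5]
        h0[of 1 5] h0[of 2 5] p
      by (elim disjE) (simp_all add: quadric_def hess_def cubic_def unit_vec_def)
  next
    case 2
    \<comment> \<open>Thirteen coordinates feed the first twelve components, hence the shift by one
      between later coordinates and components.\<close>
    then obtain m where "j = Suc m" "12 \<le> m"
      by (cases j) auto
    then show ?thesis
      using 2 unit[of j m] by (simp add: stanley_form_def unit_vec_def)
  qed (rule w)
next
  fix c :: "nat \<Rightarrow> complex" and i
  assume orth: "\<And>z w. \<lbrakk>\<And>j. Suc p \<le> j \<Longrightarrow> z j = 0; \<And>j. Suc p \<le> j \<Longrightarrow> w j = 0\<rbrakk>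
      \<Longrightarrow> (\<Sum>i<p. c i * stanley_form z w i) = 0"
    and i: "i < p"
  define u v where "u i = c i + \<i> * c (i + 6)" and "v i = c i - \<i> * c (i + 6)" for i
  have unit: "(\<Sum>i<6. u i * quadric (unit_vec a) (unit_vec b) i + v i * hess (unit_vec a) (unit_vec b) i)
      + (\<Sum>i=12..<p. c i * (unit_vec a (Suc i) * unit_vec b (Suc i))) = 0"
    if "a \<le> p" "b \<le> p" for a b
  proof -
    have "(\<Sum>i<p. c i * stanley_form (unit_vec a) (unit_vec b) i) = 0"
      using that by (intro orth) (auto simp: unit_vec_def)
    then show ?thesis
      by (simp add: sum_split_12[OF p] stanley_form_sum_12 u_def v_def)
         (simp add: stanley_form_def)
  qed
  have small: "(\<Sum>i<6. u i * quadric (unit_vec a) (unit_vec b) i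
      + v i * hess (unit_vec a) (unit_vec b) i) = 0" if "a \<le> 2" "b \<le> 12" for a b
  proof -
    have "(\<Sum>i=12..<p. c i * (unit_vec a (Suc i) * unit_vec b (Suc i))) = 0"
      using that by (intro sum.neutral) (auto simp: unit_vec_def)
    with unit[of a b] show ?thesis
      using that p by simp
  qed
  \<comment> \<open>Pairs among coordinates 0, 1, 2 make \<open>hess\<close> vanish and give
    \<open>u i = 0\<close>. Coordinate 0 with the variables y_0ab makes \<open>quadric\<close>
    vanish and hits each entry ab of \<open>hess\<close> once, giving
    \<open>v i = 0\<close>.\<close>
  have uv: "u i = 0 \<and> v i = 0" if "i < 6" for i
    using less_6_cases[OF that]
      small[of 0 0] small[of 0 1] small[of 1 1] small[of 0 2] small[of 1 2] small[of 2 2]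
      small[of 0 3] small[of 0 4] small[of 0 5] small[of 0 7] small[of 0 8] small[of 0 10]
    by (elim disjE) (simp_all add: lessThan_Suc eval_nat_numeral unit_vec_def quadric_def hess_def cubic_def)
  have c6: "c i = 0 \<and> c (i + 6) = 0" if "i < 6" for i
  proof -
    have "2 * c i = u i + v i" "2 * \<i> * c (i + 6) = u i - v i"
      by (simp_all add: u_def v_def)
    then show ?thesis
      using uv[OF that] by simp
  qed
  consider "i < 6" | "6 \<le> i" "i < 12" | "12 \<le> i"
    by linarith
  then show "c i = 0"
  proof cases
    case 2
    then show ?thesis using c6[of "i - 6"] by simp
  next
    case 3
    have "(\<Sum>j<6. u j * quadric (unit_vec (Suc i)) (unit_vec (Suc i)) j
        + v j * hess (unit_vec (Suc i)) (unit_vec (Suc i)) j) = 0"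
      using uv by (intro sum.neutral) simp
    moreover have "(\<Sum>j=12..<p. c j * (unit_vec (Suc i) (Suc j) * unit_vec (Suc i) (Suc j)))
        = (\<Sum>j=12..<p. if j = i then c j else 0)"
      by (intro sum.cong) (auto simp: unit_vec_def)
    ultimately show ?thesis
      using unit[of "Suc i" "Suc i"] 3 i by simp
  qed (use c6 in simp)
qed

theorem mainTheorem3:
  shows "\<forall>p::nat. 12 \<le> p \<longrightarrow>
    (\<exists>n::nat. 2 * p \<le> n \<and>
      (\<exists>(V :: fin_seq set) (U :: fin_seq set) J g \<alpha>.
         subspace V \<and> dim V = n \<and>
         subspace U \<and> dim U = p \<and>
         linear_on V V J \<and> (\<forall>X\<in>V. J (J X) = - X) \<and>
         pos_def_inner_on U g \<and>
         symmetric_bilinear_on V U \<alpha> \<and>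
         (\<forall>X\<in>V. \<forall>Y\<in>V. \<alpha> (J X) Y = \<alpha> X (J Y)) \<and>
         symmetric_bilinear_on V (U \<times> U) (beta_form J \<alpha>) \<and>
         flat_on V (split_inner g) (beta_form J \<alpha>) \<and>
         nondegenerate_in (U \<times> U) (split_inner g) (bil_span V (beta_form J \<alpha>)) \<and>
         dim (bil_nullity V (beta_form J \<alpha>)) < n - 2 * p))"
proof (intro allI impI)
  fix p :: nat
  assume p: "12 \<le> p"
  interpret complex_flat_form "Suc p" p stanley_form
    by (rule complex_flat_form_stanley_form[OF p])
  show "\<exists>n::nat. 2 * p \<le> n \<and>
      (\<exists>(V :: fin_seq set) (U :: fin_seq set) J g \<alpha>.
         subspace V \<and> dim V = n \<and>
         subspace U \<and> dim U = p \<and>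
         linear_on V V J \<and> (\<forall>X\<in>V. J (J X) = - X) \<and>
         pos_def_inner_on U g \<and>
         symmetric_bilinear_on V U \<alpha> \<and>
         (\<forall>X\<in>V. \<forall>Y\<in>V. \<alpha> (J X) Y = \<alpha> X (J Y)) \<and>
         symmetric_bilinear_on V (U \<times> U) (beta_form J \<alpha>) \<and>
         flat_on V (split_inner g) (beta_form J \<alpha>) \<and>
         nondegenerate_in (U \<times> U) (split_inner g) (bil_span V (beta_form J \<alpha>)) \<and>
         dim (bil_nullity V (beta_form J \<alpha>)) < n - 2 * p)"
  \<comment> \<open>C^(p+1) has real dimension 2p + 2, so n - 2p = 2 and zero nullity is small
    enough.\<close>
  proof (rule exI[of _ "2 * Suc p"], rule conjI, simp, rule exI[of _ V], rule exI[of _ U],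
      rule exI[of _ J], rule exI[of _ "coord_inner p"], rule exI[of _ \<alpha>], intro conjI ballI)
    have "dim {0 :: fin_seq} = 0"
      by (rule dim_unique[of "{}"]) (simp_all add: independent_empty)
    then show "dim (bil_nullity V \<beta>) < 2 * Suc p - 2 * p"
      unfolding nullity_beta by simp
  qed (assumption | rule subspace_coord_space dim_coord_space linear_on_mult_i
      mult_i_mult_i pos_def_coord_inner symmetric_bilinear_alpha alpha_J symmetric_bilinear_beta flat_beta nondegenerate_beta)+
qed

end
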